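(* As formal power series in $x$ with coefficients polynomials in $t$, $$\sum_{n\geq 1} \chi_{\mathcal L(\mathcal H_{2n-1})}(t)\, x^n = \sum_{n\geq 1}\frac{(t-1)_{n}\,(t-1)_{n-1}\,x^n}{\prod_{k=1}^n\bigl(1-k(t-k)x\bigr)},$$ where $\mathcal H_{2n-1}=\{x_i-x_j=y_i:1\le i<j\le n+1\}$ is the arrangement in $\mathbb R^{2n+2}$ and $(a)_{n}=a(a-1)\cdots(a-n+1)$ denotes the falling factorial (with $(a)_0=1$).
   Context: $\mathcal L(\mathcal A)$ is the intersection lattice of an arrangement (nonempty intersections of hyperplanes ordered by reverse inclusion). For a finite ranked poset $P$ of length $r$ with minimum $\hat 0$, the characteristic polynomial is $\chi_P(t)=\sum_{x\in P}\mu_P(\hat 0,x)t^{r-\mathrm{rk}(x)}$. *)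

theory Defs
  imports
    "HOL-Computational_Algebra.Formal_Power_Series"
    "HOL-Computational_Algebra.Polynomial"
    "Jordan_Normal_Form.Matrix"
begin

text \<open>
  A finite poset is represented by its order relation \<open>r\<close>, a set of pairs \<open>(x, y)\<close> with
  \<open>x \<le> y\<close>; reflexivity makes \<open>Field r\<close> the ground set.
\<close>

definition poset_bot :: "'a rel \<Rightarrow> 'a" where
  "poset_bot r = (THE z. z \<in> Field r \<and> (\<forall>x\<in>Field r. (z, x) \<in> r))"

text \<open>
  The length of a chain \<open>C\<close> is \<open>card C - 1\<close>. In a finite ranked poset with a minimum, the rank
  of \<open>x\<close> is the length of a longest chain below \<open>x\<close>.
\<close>

definition poset_length :: "'a rel \<Rightarrow> nat" where
  "poset_length r = Max ((\<lambda>C. card C - 1) ` Chains r)"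

definition poset_rank :: "'a rel \<Rightarrow> 'a \<Rightarrow> nat" where
  "poset_rank r x = Max ((\<lambda>C. card C - 1) ` {C \<in> Chains r. C \<subseteq> under r x})"

text \<open>
  The usual recursion \<open>\<mu>(x, x) = 1\<close> and \<open>\<mu>(x, y) = - (\<Sum>x \<le> z < y. \<mu>(x, z))\<close>. The value 0 for
  relations that are not finite partial orders only serves to make the recursion terminate.
\<close>

function poset_moebius :: "'a rel \<Rightarrow> 'a \<Rightarrow> 'a \<Rightarrow> int" where
  "poset_moebius r x y =
     (if finite r \<and> partial_order_on (Field r) r \<and> (x, y) \<in> r
      then if x = y then 1
           else - (\<Sum>z | (x, z) \<in> r \<and> (z, y) \<in> r \<and> z \<noteq> y. poset_moebius r x z)
      else 0)"
  by pat_completeness auto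
termination
proof (relation "measure (\<lambda>(r, x, y). card (under r y))", goal_cases)
  case 1
  show ?case by simp
next
  case (2 r x y z)
  then have z: "(z, y) \<in> r" "z \<noteq> y" and po: "partial_order_on (Field r) r" and fin: "finite r"
    by auto
  have "under r z \<subset> under r y"
  proof
    show "under r z \<subseteq> under r y"
      using z po by (auto simp: under_def partial_order_on_def preorder_on_def dest: transD)
    show "under r z \<noteq> under r y"
    proof
      assume "under r z = under r y"
      moreover have "y \<in> under r y"
        using z po by (auto simp: under_def partial_order_on_def preorder_on_def
            intro: refl_onD FieldI2)
      ultimately have "(y, z) \<in> r" by (auto simp: under_def)
      with z po show False by (auto simp: partial_order_on_def dest: antisymD)
    qed
  qed
  moreover have "finite (under r y)"
    by (rule finite_subset[of _ "Field r"]) (auto simp: under_def fin finite_Field intro: FieldI1)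
  ultimately show ?case by (simp add: psubset_card_mono)
qed

declare poset_moebius.simps [simp del]

definition poset_charpoly :: "'a rel \<Rightarrow> int poly" where
  "poset_charpoly r =
     (\<Sum>x\<in>Field r. Polynomial.monom (poset_moebius r (poset_bot r) x)
                       (poset_length r - poset_rank r x))"

text \<open>
  Intersecting with the ambient space \<open>V\<close> makes the empty intersection equal to \<open>V\<close>.
\<close>

definition arrangement_flats :: "'v set \<Rightarrow> 'v set set \<Rightarrow> 'v set set" where
  "arrangement_flats V \<A> = {X. X \<noteq> {} \<and> (\<exists>\<B>\<subseteq>\<A>. X = V \<inter> \<Inter>\<B>)}"

definition intersection_lattice :: "'v set \<Rightarrow> 'v set set \<Rightarrow> 'v set rel" where
  "intersection_lattice V \<A> =
     {(X, Y). X \<in> arrangement_flats V \<A> \<and> Y \<in> arrangement_flats V \<A> \<and> Y \<subseteq> X}"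

text \<open>
  The arrangement \<open>\<H>\<^bsub>2n-1\<^esub>\<close>. A point \<open>(x\<^sub>1, \<dots>, x\<^bsub>n+1\<^esub>, y\<^sub>1, \<dots>, y\<^bsub>n+1\<^esub>)\<close> is a vector of
  dimension \<open>2 * n + 2\<close> with entries indexed from 0.
\<close>

definition coord_x :: "real vec \<Rightarrow> nat \<Rightarrow> real" where
  "coord_x v i = v $ (i - 1)"

definition coord_y :: "nat \<Rightarrow> real vec \<Rightarrow> nat \<Rightarrow> real" where
  "coord_y n v i = v $ (n + i)"

definition homogenized_linial :: "nat \<Rightarrow> real vec set set" where
  "homogenized_linial n =
     {{v \<in> carrier_vec (2 * n + 2). coord_x v i - coord_x v j = coord_y n v i} | i j.
        1 \<le> i \<and> i < j \<and> j \<le> n + 1}"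

definition linial_charpoly :: "nat \<Rightarrow> int poly" where
  "linial_charpoly n =
     poset_charpoly (intersection_lattice (carrier_vec (2 * n + 2)) (homogenized_linial n))"

definition falling_factorial :: "'a::comm_ring_1 \<Rightarrow> nat \<Rightarrow> 'a" where
  "falling_factorial a n = (\<Prod>i<n. a - of_nat i)"

text \<open>
  Division by a power series with constant coefficient 1. The coefficient ring is not assumed to
  have an inverse operation, so the division of the class of fields is not available.
\<close>

definition fps_quotient :: "'a::comm_ring_1 fps \<Rightarrow> 'a fps \<Rightarrow> 'a fps" where
  "fps_quotient f g = f * fps_right_inverse g 1"

lemma fps_quotient_mult:
  assumes "fps_nth g 0 = 1"
  shows "g * fps_quotient f g = f"
proof -
  have "g * fps_right_inverse g 1 = 1"
    by (rule fps_right_inverse) (simp add: assms)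
  then show ?thesis
    by (simp add: fps_quotient_def mult.left_commute)
qed

end

theory Submission
  imports Defs
begin

text \<open>
  In the coordinates \<open>u\<^sub>i = x\<^sub>i - y\<^sub>i\<close> the hyperplanes become \<open>u\<^sub>i = x\<^sub>j\<close> for \<open>i < j\<close>, so
  \<open>\<H>\<^bsub>2n-1\<^esub>\<close> is the graphical arrangement of a connected bipartite Ferrers graph on \<open>2n\<close> vertices.
  A colouring with a finite set of real colours is a point of the ambient space, and a flat
  of dimension \<open>d\<close> contains \<open>q\<^sup>d\<close> of the \<open>q\<close>-colourings; Moebius inversion over the lattice of flats
  thus shows that \<open>q \<chi>(q)\<close> counts the proper \<open>q\<close>-colourings.

  Colour the vertices in the order \<open>u\<^sub>1, x\<^sub>2, u\<^sub>2, x\<^sub>3, \<dots>\<close> and let \<open>k\<close> be the number of colours used on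
  the \<open>u\<close>-vertices so far. The next \<open>u\<close> has \<open>k\<close> choices that keep \<open>k\<close> and \<open>q - k\<close> that increase it, and
  each \<open>x\<close> has \<open>q - k\<close> choices. The colourings that end with \<open>k\<close> therefore have a generating function
  \<open>F\<^sub>k\<close> with \<open>(1 - k(q - k)x) F\<^sub>k = (q - k)(q - k + 1) x F\<^bsub>k-1\<^esub>\<close>, and \<open>F\<^sub>k\<close> is \<open>q\<close> times the \<open>k\<close>-th summand
  of the right-hand side.
\<close>

section \<open>Graphical arrangements and proper colourings\<close>

text \<open>The map \<open>\<rho>\<close> sends a vertex to a representative of its component in the
  graph with edge set \<open>B\<close>. It is built by adding one edge at a time.\<close>

lemma vertex_retraction:
  assumes "finite B" "B \<subseteq> S \<times> S"
  obtains \<rho> where "\<rho> ` S \<subseteq> S" "\<And>a. a \<in> S \<Longrightarrow> \<rho> (\<rho> a) = \<rho> a"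
    "\<And>w :: 'a \<Rightarrow> 'c. (\<forall>(a, b)\<in>B. w a = w b) \<longleftrightarrow> (\<forall>a\<in>S. w a = w (\<rho> a))"
  using assms
proof (induction B arbitrary: thesis rule: finite_induct)
  case empty
  show ?case by (rule empty(1)[of id]) auto
next
  case (insert e B)
  obtain x y where e: "e = (x, y)" by (cases e)
  with insert.prems have xy: "x \<in> S" "y \<in> S" by auto
  obtain \<rho> where \<rho>: "\<rho> ` S \<subseteq> S" "\<And>a. a \<in> S \<Longrightarrow> \<rho> (\<rho> a) = \<rho> a"
    "\<And>w :: 'a \<Rightarrow> 'c. (\<forall>(a, b)\<in>B. w a = w b) \<longleftrightarrow> (\<forall>a\<in>S. w a = w (\<rho> a))"
    using insert.IH insert.prems by auto
  \<comment> \<open>The new edge merges the component of \<open>y\<close> into that of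
    \<open>x\<close>, whose representative is kept.\<close>
  define \<rho>' where "\<rho>' a = (if \<rho> a = \<rho> y then \<rho> x else \<rho> a)" for a
  have iff: "(\<forall>(a, b)\<in>insert e B. w a = w b) \<longleftrightarrow> (\<forall>a\<in>S. w a = w (\<rho>' a))" for w :: "'a \<Rightarrow> 'c"
  proof -
    have "(\<forall>(a, b)\<in>insert e B. w a = w b) \<longleftrightarrow> w x = w y \<and> (\<forall>a\<in>S. w a = w (\<rho> a))"
      using \<rho>(3)[of w] e by auto
    also have "\<dots> \<longleftrightarrow> (\<forall>a\<in>S. w a = w (\<rho>' a))"
    proof safe
      fix a assume "w x = w y" "\<forall>a\<in>S. w a = w (\<rho> a)" "a \<in> S"
      moreover from this have "w y = w (\<rho> y)" "w x = w (\<rho> x)" "w a = w (\<rho> a)" using xy by blast+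
      ultimately show "w a = w (\<rho>' a)" by (simp add: \<rho>'_def)
    next
      assume *: "\<forall>a\<in>S. w a = w (\<rho>' a)"
      have "w x = w (\<rho>' x)" "w y = w (\<rho>' y)" using * xy by blast+
      then show "w x = w y" by (simp add: \<rho>'_def split: if_splits)
    next
      fix a assume *: "\<forall>a\<in>S. w a = w (\<rho>' a)" and a: "a \<in> S"
      have "\<rho>' (\<rho> a) = \<rho>' a" using \<rho>(2)[OF a] by (simp add: \<rho>'_def)
      then show "w a = w (\<rho> a)" using * a \<rho>(1) by (metis image_subset_iff)
    qed
    finally show ?thesis .
  qed
  show ?case
  proof (rule insert.prems(1)[of \<rho>'])
    show "\<rho>' ` S \<subseteq> S" using \<rho>(1) xy by (auto simp: \<rho>'_def)
    show "\<rho>' (\<rho>' a) = \<rho>' a" if "a \<in> S" for a using \<rho>(2) that xy by (auto simp: \<rho>'_def)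
  qed (fact iff)
qed

text \<open>An invariant colouring is determined by its values on the representatives, and these are
  free.\<close>

lemma card_retraction_invariant:
  assumes "finite S" "\<rho> ` S \<subseteq> S" "\<And>a. a \<in> S \<Longrightarrow> \<rho> (\<rho> a) = \<rho> a"
  shows "card {c \<in> S \<rightarrow>\<^sub>E Q. \<forall>a\<in>S. c a = c (\<rho> a)} = card Q ^ card (\<rho> ` S)"
proof -
  have "bij_betw (\<lambda>c. restrict c (\<rho> ` S)) {c \<in> S \<rightarrow>\<^sub>E Q. \<forall>a\<in>S. c a = c (\<rho> a)} (\<rho> ` S \<rightarrow>\<^sub>E Q)"
  proof (rule bij_betw_byWitness[where f' = "\<lambda>d. restrict (d \<circ> \<rho>) S"])
    show "\<forall>c\<in>{c \<in> S \<rightarrow>\<^sub>E Q. \<forall>a\<in>S. c a = c (\<rho> a)}. restrict (restrict c (\<rho> ` S) \<circ> \<rho>) S = c"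
      by (auto simp: fun_eq_iff restrict_def PiE_def extensional_def)
    show "\<forall>d\<in>\<rho> ` S \<rightarrow>\<^sub>E Q. restrict (restrict (d \<circ> \<rho>) S) (\<rho> ` S) = d"
      using assms(2,3) by (auto simp: fun_eq_iff restrict_def PiE_def extensional_def)
    show "(\<lambda>c. restrict c (\<rho> ` S)) ` {c \<in> S \<rightarrow>\<^sub>E Q. \<forall>a\<in>S. c a = c (\<rho> a)} \<subseteq> \<rho> ` S \<rightarrow>\<^sub>E Q"
      using assms(2) by (auto simp: PiE_def Pi_def extensional_def)
    show "(\<lambda>d. restrict (d \<circ> \<rho>) S) ` (\<rho> ` S \<rightarrow>\<^sub>E Q) \<subseteq> {c \<in> S \<rightarrow>\<^sub>E Q. \<forall>a\<in>S. c a = c (\<rho> a)}"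
      using assms(2,3) by (auto simp: PiE_def Pi_def extensional_def image_subset_iff)
  qed
  then show ?thesis
    using assms(1) by (simp add: bij_betw_same_card card_funcsetE)
qed

text \<open>
  The value \<open>\<phi> v a\<close> is the coordinate of the point \<open>v\<close> at the vertex \<open>a\<close>. The ambient space may have
  further coordinates, so \<open>\<phi>\<close> need not be injective; \<open>\<psi>\<close> is a section of it.
\<close>

locale graphical_arrangement =
  fixes V :: "'v set" and S :: "'a set" and E :: "('a \<times> 'a) set"
    and \<phi> :: "'v \<Rightarrow> 'a \<Rightarrow> real" and \<psi> :: "('a \<Rightarrow> real) \<Rightarrow> 'v"
  assumes finite_vertices: "finite S" and vertices_nonempty: "S \<noteq> {}"
    and edges: "E \<subseteq> S \<times> S" and no_loops: "(a, a) \<notin> E"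
    and section_mem: "\<psi> w \<in> V" and coord_section: "a \<in> S \<Longrightarrow> \<phi> (\<psi> w) a = w a"
    and connected: "(\<And>a b. (a, b) \<in> E \<Longrightarrow> w a = w b) \<Longrightarrow> a \<in> S \<Longrightarrow> b \<in> S \<Longrightarrow> w a = (w b :: real)"
begin

section \<open>Flats of a graphical arrangement and their lattice\<close>

text \<open>Flats are indexed by edge sets; different edge sets can give the same flat.\<close>

definition flat :: "('a \<times> 'a) set \<Rightarrow> 'v set" where
  "flat B = {v \<in> V. \<forall>(a, b)\<in>B. \<phi> v a = \<phi> v b}"

definition arrangement :: "'v set set" where
  "arrangement = (\<lambda>(a, b). {v \<in> V. \<phi> v a = \<phi> v b}) ` E"

definition lattice :: "'v set rel" where
  "lattice = intersection_lattice V arrangement"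

definition colourings :: "real set \<Rightarrow> 'v set \<Rightarrow> ('a \<Rightarrow> real) set" where
  "colourings Q X = {c \<in> S \<rightarrow>\<^sub>E Q. \<psi> c \<in> X}"

lemma finite_edges: "finite E"
  using edges finite_vertices by (meson finite_SigmaI finite_subset)

lemma section_flat: "B \<subseteq> E \<Longrightarrow> \<psi> w \<in> flat B \<longleftrightarrow> (\<forall>(a, b)\<in>B. w a = w b)"
  using edges section_mem by (fastforce simp: flat_def coord_section)

text \<open>The point \<open>\<psi> (\<lambda>_. 0)\<close> lies on all hyperplanes, so every edge
  set yields a nonempty intersection.\<close>

lemma arrangement_flats_eq: "arrangement_flats V arrangement = flat ` Pow E"
proof -
  have *: "V \<inter> \<Inter> ((\<lambda>(a, b). {v \<in> V. \<phi> v a = \<phi> v b}) ` B) = flat B" for B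
    by (auto simp: flat_def)
  have "\<psi> (\<lambda>_. 0) \<in> flat B" if "B \<subseteq> E" for B
    using section_flat[OF that] by auto
  then have "flat B \<noteq> {}" if "B \<subseteq> E" for B using that by blast
  then show ?thesis
    unfolding arrangement_flats_def arrangement_def subset_image_iff
    using * by (auto simp: Pow_def image_iff) (metis)+
qed

lemma lattice_eq: "lattice = {(X, Y). X \<in> flat ` Pow E \<and> Y \<in> flat ` Pow E \<and> Y \<subseteq> X}"
  by (simp add: lattice_def intersection_lattice_def arrangement_flats_eq)

lemma Field_lattice: "Field lattice = flat ` Pow E"
  by (auto simp: lattice_eq Field_def)

lemma flat_empty: "flat {} = V"
  by (simp add: flat_def)

lemma flat_antimono: "A \<subseteq> B \<Longrightarrow> flat B \<subseteq> flat A"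
  by (auto simp: flat_def)

lemma poset_bot_lattice: "poset_bot lattice = V"
  unfolding poset_bot_def
proof (rule the_equality)
  have "V \<in> flat ` Pow E" using flat_empty by blast
  then show V: "V \<in> Field lattice \<and> (\<forall>X\<in>Field lattice. (V, X) \<in> lattice)"
    unfolding Field_lattice by (auto simp: lattice_eq) (auto simp: flat_def)
  show "Z = V" if "Z \<in> Field lattice \<and> (\<forall>X\<in>Field lattice. (Z, X) \<in> lattice)" for Z
  proof (rule subset_antisym)
    show "Z \<subseteq> V" using that by (auto simp: Field_lattice flat_def)
    have "(Z, V) \<in> lattice" using that V by blast
    then show "V \<subseteq> Z" by (simp add: lattice_eq)
  qed
qed

lemma finite_flats: "finite (flat ` Pow E)"
  using finite_edges by simp

lemma finite_lattice: "finite lattice"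
  by (rule finite_subset[of _ "flat ` Pow E \<times> flat ` Pow E"]) (use finite_flats in \<open>auto simp: lattice_eq\<close>)

lemma partial_order_lattice: "partial_order_on (Field lattice) lattice"
  unfolding partial_order_on_def preorder_on_def Field_lattice
  by (auto simp: lattice_eq refl_on_def trans_def antisym_def)

text \<open>The recursion that defines mu, with the term at \<open>Y\<close> moved to the other
  side; the interval from \<open>V\<close> to \<open>Y\<close> consists of the flats that contain
  \<open>Y\<close>.\<close>

lemma sum_moebius_lattice:
  assumes "Y \<in> flat ` Pow E"
  shows "(\<Sum>X | X \<in> flat ` Pow E \<and> Y \<subseteq> X. poset_moebius lattice V X) = (if Y = V then 1 else 0)"
proof -
  have V: "V \<in> flat ` Pow E" using flat_empty by blast
  have sub: "X \<subseteq> V" if "X \<in> flat ` Pow E" for X using that by (auto simp: flat_def)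
  have rel: "(V, Y) \<in> lattice" using assms V sub by (auto simp: lattice_eq)
  let ?U = "{Z. (V, Z) \<in> lattice \<and> (Z, Y) \<in> lattice \<and> Z \<noteq> Y}"
  have U: "{X. X \<in> flat ` Pow E \<and> Y \<subseteq> X} = insert Y ?U"
    using assms V sub by (auto simp: lattice_eq)
  have "finite ?U" using finite_flats by (rule finite_subset[rotated]) (auto simp: lattice_eq)
  then have "(\<Sum>X | X \<in> flat ` Pow E \<and> Y \<subseteq> X. poset_moebius lattice V X) =
      poset_moebius lattice V Y + (\<Sum>Z\<in>?U. poset_moebius lattice V Z)"
    unfolding U by (subst sum.insert) auto
  moreover have "poset_moebius lattice V Y = (if V = Y then 1 else - (\<Sum>Z\<in>?U. poset_moebius lattice V Z))"
    by (subst poset_moebius.simps) (simp add: finite_lattice partial_order_lattice rel)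
  moreover have "?U = {}" if "V = Y" using that partial_order_lattice
    by (auto simp: partial_order_on_def dest: antisymD)
  ultimately show ?thesis by (cases "V = Y") (simp_all only: sum.empty if_True if_False, simp_all)
qed

section \<open>Dimensions of flats\<close>

text \<open>The exponent is the number of representatives chosen by \<open>\<rho>\<close>, hence the
  same for all colour sets.\<close>

lemma card_colourings_flat:
  assumes "B \<subseteq> E"
  obtains k where "\<And>Q. card (colourings Q (flat B)) = card Q ^ k"
proof -
  have "finite B" "B \<subseteq> S \<times> S" using assms edges finite_edges by (auto intro: finite_subset)
  from vertex_retraction[OF this, where 'c = real] obtain \<rho> where \<rho>:
    "\<rho> ` S \<subseteq> S" "\<And>a. a \<in> S \<Longrightarrow> \<rho> (\<rho> a) = \<rho> a"
    "\<And>w :: 'a \<Rightarrow> real. (\<forall>(a, b)\<in>B. w a = w b) \<longleftrightarrow> (\<forall>a\<in>S. w a = w (\<rho> a))" by blast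
  show thesis
  proof (rule that[of "card (\<rho> ` S)"])
    show "card (colourings Q (flat B)) = card Q ^ card (\<rho> ` S)" for Q
      using card_retraction_invariant[OF finite_vertices \<rho>(1,2)]
      by (simp add: colourings_def section_flat[OF assms] \<rho>(3))
  qed
qed

text \<open>The dimension up to the coordinates that \<open>\<phi>\<close> ignores, read off from
  numbers of colourings. It refers to \<open>X\<close> alone, so no choice of an edge set
  enters.\<close>

definition dimension :: "'v set \<Rightarrow> nat" where
  "dimension X = (SOME k. \<forall>Q. card (colourings Q X) = card Q ^ k)"

lemma card_colourings:
  assumes "X \<in> flat ` Pow E"
  shows "card (colourings Q X) = card Q ^ dimension X"
proof -
  obtain B where B: "B \<subseteq> E" "X = flat B" using assms by auto
  obtain k where "\<And>Q. card (colourings Q X) = card Q ^ k"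
    using card_colourings_flat[OF B(1)] unfolding B(2) by blast
  then have "\<exists>k. \<forall>Q. card (colourings Q X) = card Q ^ k" by blast
  then have "\<forall>Q. card (colourings Q X) = card Q ^ dimension X"
    unfolding dimension_def by (rule someI_ex)
  then show ?thesis ..
qed

text \<open>Powers of 2 determine their exponents, so dimensions can be compared by comparing sets
  of 2-colourings.\<close>

lemma card_colourings_01:
  assumes "X \<in> flat ` Pow E"
  shows "card (colourings {0, 1} X) = 2 ^ dimension X"
  using card_colourings[OF assms, of "{0, 1}"] by (simp add: numeral_2_eq_2)

lemma finite_colourings: "finite Q \<Longrightarrow> finite (colourings Q X)"
  by (simp add: colourings_def finite_PiE finite_vertices)

lemma dimension_eqI:
  assumes "X \<in> flat ` Pow E" "card (colourings {0, 1} X) = 2 ^ k"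
  shows "dimension X = k"
  using assms card_colourings_01 by simp

lemma dimension_V: "dimension V = card S"
proof (rule dimension_eqI)
  show "V \<in> flat ` Pow E" using flat_empty by blast
  have "colourings {0, 1} V = S \<rightarrow>\<^sub>E {0, 1}" by (auto simp: colourings_def section_mem)
  then show "card (colourings {0, 1} V) = 2 ^ card S"
    by (simp add: card_funcsetE finite_vertices numeral_2_eq_2)
qed

text \<open>By connectedness, only the constant colourings lie in the smallest flat.\<close>

lemma dimension_flat_edges: "dimension (flat E) = 1"
proof (rule dimension_eqI)
  show "flat E \<in> flat ` Pow E" by blast
  have "colourings {0, 1} (flat E) = (\<lambda>q. \<lambda>a\<in>S. q) ` {0, 1}"
  proof (rule Set.set_eqI)
    fix c
    obtain s where s: "s \<in> S" using vertices_nonempty by blast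
    have "c \<in> colourings {0, 1} (flat E) \<longleftrightarrow> c \<in> S \<rightarrow>\<^sub>E {0, 1} \<and> (\<forall>a\<in>S. c a = c s)"
    proof -
      have "(\<forall>(a, b)\<in>E. c a = c b) \<longleftrightarrow> (\<forall>a\<in>S. c a = c s)"
      proof
        assume "\<forall>(a, b)\<in>E. c a = c b"
        then show "\<forall>a\<in>S. c a = c s" using connected[of c _ s] s by blast
      next
        assume *: "\<forall>a\<in>S. c a = c s"
        have "c a = c b" if "(a, b) \<in> E" for a b
        proof -
          have "a \<in> S" "b \<in> S" using that edges by auto
          then show ?thesis using * by simp
        qed
        then show "\<forall>(a, b)\<in>E. c a = c b" by blast
      qed
      then show ?thesis by (simp add: colourings_def section_flat)
    qed
    also have "\<dots> \<longleftrightarrow> (\<exists>q\<in>{0, 1}. c = (\<lambda>a\<in>S. q))"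
    proof
      assume *: "c \<in> S \<rightarrow>\<^sub>E {0, 1} \<and> (\<forall>a\<in>S. c a = c s)"
      have "c = (\<lambda>a\<in>S. c s)"
      proof (rule extensionalityI)
        show "c \<in> extensional S" using * by (simp add: PiE_def)
        show "c a = (\<lambda>a\<in>S. c s) a" if "a \<in> S" for a
          using *[THEN conjunct2] that by (simp add: restrict_apply')
      qed simp
      moreover have "c s \<in> {0, 1}" using PiE_mem[OF conjunct1[OF *] s] .
      ultimately show "\<exists>q\<in>{0, 1}. c = (\<lambda>a\<in>S. q)" by blast
    qed (use s in auto)
    finally show "c \<in> colourings {0, 1} (flat E) \<longleftrightarrow> c \<in> (\<lambda>q. \<lambda>a\<in>S. q) ` {0, 1}" by blast
  qed
  moreover have "inj_on (\<lambda>q::real. \<lambda>a\<in>S. q) {0, 1}"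
    using vertices_nonempty by (auto simp: inj_on_def fun_eq_iff)
  ultimately show "card (colourings {0, 1} (flat E)) = 2 ^ 1" by (simp add: card_image)
qed

lemma dimension_strict_mono:
  assumes "X \<in> flat ` Pow E" "Y \<in> flat ` Pow E" "X \<subset> Y"
  shows "dimension X < dimension Y"
proof -
  obtain B C where BC: "B \<subseteq> E" "X = flat B" "C \<subseteq> E" "Y = flat C" using assms by auto
  obtain v where v: "v \<in> flat C" "v \<notin> flat B" using assms(3) BC by blast
  then obtain a b where ab: "(a, b) \<in> B" "\<phi> v a \<noteq> \<phi> v b" by (auto simp: flat_def)
  \<comment> \<open>The indicator of the level set of \<open>v\<close> through \<open>a\<close>: it
    respects every equation that \<open>v\<close> satisfies, but it separates \<open>a\<close> from
    \<open>b\<close>.\<close>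
  define c where "c = (\<lambda>u\<in>S. if \<phi> v u = \<phi> v a then 1 else 0 :: real)"
  have "\<psi> c \<in> Y"
  proof -
    have "c x = c y" if "(x, y) \<in> C" for x y
    proof -
      have "\<phi> v x = \<phi> v y" using v(1) that by (auto simp: flat_def)
      moreover have "x \<in> S" "y \<in> S" using that BC(3) edges by auto
      ultimately show ?thesis by (simp add: c_def)
    qed
    then show ?thesis unfolding BC(4) section_flat[OF BC(3)] by blast
  qed
  moreover have "\<psi> c \<notin> X"
    using ab BC edges by (auto simp: section_flat c_def intro!: bexI[of _ "(a, b)"])
  moreover have "c \<in> S \<rightarrow>\<^sub>E {0, 1}" by (auto simp: c_def)
  ultimately have "colourings {0, 1} X \<subset> colourings {0, 1} Y"
    using assms(3) by (auto simp: colourings_def)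
  then have "card (colourings {0, 1} X) < card (colourings {0, 1} Y)"
    by (simp add: psubset_card_mono finite_colourings)
  then show ?thesis using assms by (simp add: card_colourings_01)
qed

text \<open>
  Recolouring the class of \<open>y\<close> with the colour of \<open>x\<close> loses only the colour of \<open>y\<close>, so the number of
  2-colourings in a flat at most halves when an edge is added.
\<close>

lemma dimension_insert:
  assumes "insert e B \<subseteq> E"
  shows "dimension (flat B) \<le> Suc (dimension (flat (insert e B)))"
proof -
  obtain x y where e: "e = (x, y)" by (cases e)
  have xy: "x \<in> S" "y \<in> S" using assms e edges by auto
  \<comment> \<open>\<open>cls v\<close> says that the equations of \<open>B\<close> force
    \<open>v\<close> to have the colour of \<open>y\<close>, which describes the component of
    \<open>y\<close> without paths.\<close>
  define cls where "cls v \<longleftrightarrow> (\<forall>w :: 'a \<Rightarrow> real. (\<forall>(a, b)\<in>B. w a = w b) \<longrightarrow> w v = w y)" for v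
  define f where "f c = ((\<lambda>v\<in>S. if cls v then c x else c v), c y)" for c :: "'a \<Rightarrow> real"
  have cls: "cls a \<longleftrightarrow> cls b" if "(a, b) \<in> B" for a b
  proof -
    have "w a = w b" if "\<forall>(a, b)\<in>B. w a = w b" for w :: "'a \<Rightarrow> real"
      using that \<open>(a, b) \<in> B\<close> by blast
    then have "((\<forall>(a, b)\<in>B. w a = w b) \<longrightarrow> w a = w y) \<longleftrightarrow> ((\<forall>(a, b)\<in>B. w a = w b) \<longrightarrow> w b = w y)"
      for w :: "'a \<Rightarrow> real" by metis
    then show ?thesis unfolding cls_def by presburger
  qed
  have "f ` colourings {0, 1} (flat B) \<subseteq> colourings {0, 1} (flat (insert e B)) \<times> {0, 1}"
  proof (rule image_subsetI)
    fix c assume c: "c \<in> colourings {0, 1} (flat B)"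
    have cB: "c a = c b" if "(a, b) \<in> B" for a b
      using c that assms by (auto simp: colourings_def section_flat)
    have c01: "c \<in> S \<rightarrow>\<^sub>E {0, 1}" using c by (simp add: colourings_def)
    define d where d: "d = (\<lambda>v\<in>S. if cls v then c x else c v)"
    have "cls y" by (simp add: cls_def)
    then have "d x = d y" using xy by (simp add: d)
    moreover have "d a = d b" if "(a, b) \<in> B" for a b
    proof -
      have "a \<in> S" "b \<in> S" using that assms edges by auto
      then show ?thesis using cls[OF that] cB[OF that] by (simp add: d)
    qed
    ultimately have "\<psi> d \<in> flat (insert e B)" using assms by (auto simp: section_flat e)
    moreover have "d \<in> S \<rightarrow>\<^sub>E {0, 1}" unfolding d using c01 xy by (auto simp: PiE_iff)
    ultimately have "d \<in> colourings {0, 1} (flat (insert e B))" by (simp add: colourings_def)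
    moreover have "c y \<in> {0, 1}" using c01 xy by auto
    ultimately show "f c \<in> colourings {0, 1} (flat (insert e B)) \<times> {0, 1}" by (simp add: f_def d)
  qed
  moreover have "inj_on f (colourings {0, 1} (flat B))"
  proof (rule inj_onI)
    fix c d assume cd: "c \<in> colourings {0, 1} (flat B)" "d \<in> colourings {0, 1} (flat B)" "f c = f d"
    \<comment> \<open>This recovers \<open>w\<close> from \<open>f w\<close>: its second component
      restores the colour of the class of \<open>y\<close>, and the first is unchanged
      elsewhere.\<close>
    have *: "w v = (if cls v then w y else fst (f w) v)" if "w \<in> colourings {0, 1} (flat B)" "v \<in> S" for w v
      using that assms by (auto simp: cls_def f_def colourings_def section_flat)
    have "c y = d y" using cd(3) by (simp add: f_def)
    then have "c v = d v" if "v \<in> S" for v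
      using *[OF cd(1) that] *[OF cd(2) that] cd(3) by simp
    moreover have "c \<in> extensional S" "d \<in> extensional S" using cd by (auto simp: colourings_def PiE_def)
    ultimately show "c = d" by (auto intro: extensionalityI)
  qed
  ultimately have "card (colourings {0, 1} (flat B)) \<le>
      card (colourings {0, 1} (flat (insert e B)) \<times> {0 :: real, 1})"
    by (intro card_inj_on_le) (auto simp: finite_colourings)
  then have "(2::nat) ^ dimension (flat B) \<le> 2 ^ dimension (flat (insert e B)) * 2"
    using assms by (simp add: card_colourings_01 card_cartesian_product)
  then have "(2::nat) ^ dimension (flat B) \<le> 2 ^ Suc (dimension (flat (insert e B)))" by simp
  then show ?thesis by (subst (asm) power_increasing_iff) auto
qed

lemma dimension_mono:
  assumes "X \<in> flat ` Pow E" "Y \<in> flat ` Pow E" "X \<subseteq> Y"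
  shows "dimension X \<le> dimension Y"
proof (cases "X = Y")
  case False
  then have "X \<subset> Y" using assms(3) by blast
  then show ?thesis using dimension_strict_mono[OF assms(1,2)] by simp
qed simp

lemma dimension_le: "X \<in> flat ` Pow E \<Longrightarrow> dimension X \<le> card S"
  using dimension_mono[of X V] flat_empty by (auto simp: dimension_V flat_def)

lemma dimension_pos: "X \<in> flat ` Pow E \<Longrightarrow> 0 < dimension X"
  using dimension_mono[of "flat E" X] dimension_flat_edges flat_antimono[of _ E] by auto

section \<open>Rank and length of the lattice\<close>

text \<open>Adding the edges of \<open>B\<close> one at a time either keeps the flat or extends the
  chain, and by \<open>dimension_insert\<close> each extension costs at most one dimension.\<close>

lemma chain_to_flat:
  assumes "B \<subseteq> E"
  shows "\<exists>C \<in> Chains lattice. C \<subseteq> under lattice (flat B) \<and> flat B \<in> C \<and>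
    Suc (card S) \<le> card C + dimension (flat B)"
proof -
  have "finite B" using assms finite_edges by (rule finite_subset)
  then show ?thesis using assms
  proof (induction B rule: finite_induct)
    case empty
    have "V \<in> flat ` Pow E" using flat_empty by blast
    then show ?case
      by (intro bexI[of _ "{V}"]) (auto simp: flat_empty dimension_V Chains_def under_def lattice_eq)
  next
    case (insert e B)
    then obtain C where C: "C \<in> Chains lattice" "C \<subseteq> under lattice (flat B)" "flat B \<in> C"
      "Suc (card S) \<le> card C + dimension (flat B)" by auto
    have sub: "flat (insert e B) \<subseteq> flat B" by (rule flat_antimono) auto
    have mem: "flat (insert e B) \<in> flat ` Pow E" using insert.prems by blast
    have fin: "finite C" using C(2) finite_flats
      by (rule_tac finite_subset[of _ "flat ` Pow E"]) (auto simp: under_def lattice_eq)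
    show ?case
    proof (cases "flat (insert e B) = flat B")
      case True
      then show ?thesis using C by auto
    next
      case False
      then have new: "flat (insert e B) \<notin> C" using C(2) sub by (auto simp: under_def lattice_eq)
      have "(Y, flat (insert e B)) \<in> lattice" if "Y \<in> C" for Y
      proof -
        have "(Y, flat B) \<in> lattice" using C(2) that by (auto simp: under_def)
        then show ?thesis using sub mem unfolding lattice_eq by blast
      qed
      moreover have "(flat (insert e B), flat (insert e B)) \<in> lattice"
        using mem by (simp add: lattice_eq)
      ultimately have le: "(Y, flat (insert e B)) \<in> lattice" if "Y \<in> insert (flat (insert e B)) C" for Y
        using that by blast
      then have "insert (flat (insert e B)) C \<in> Chains lattice"
        using C(1) unfolding Chains_def by blast
      moreover have "insert (flat (insert e B)) C \<subseteq> under lattice (flat (insert e B))"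
        using le by (auto simp: under_def)
      moreover have "Suc (card S) \<le> card (insert (flat (insert e B)) C) + dimension (flat (insert e B))"
        using C(4) dimension_insert[OF insert.prems] fin new by simp
      ultimately show ?thesis by blast
    qed
  qed
qed

text \<open>Dimensions are distinct along a chain and lie between \<open>dimension X\<close> and
  \<open>card S\<close>.\<close>

lemma card_chain_le:
  assumes "C \<in> Chains lattice" "C \<subseteq> under lattice X" "X \<in> flat ` Pow E"
  shows "card C \<le> Suc (card S) - dimension X"
proof -
  have C: "Y \<in> flat ` Pow E" "X \<subseteq> Y" if "Y \<in> C" for Y
    using assms(2) that by (auto simp: under_def lattice_eq)
  have "inj_on dimension C"
  proof (rule inj_onI)
    fix Y Z assume YZ: "Y \<in> C" "Z \<in> C" "dimension Y = dimension Z"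
    then have "(Y, Z) \<in> lattice \<or> (Z, Y) \<in> lattice" using assms(1) by (auto simp: Chains_def)
    then have "Y \<subseteq> Z \<or> Z \<subseteq> Y" by (auto simp: lattice_eq)
    then show "Y = Z"
      using YZ(3) dimension_strict_mono[OF C(1)[OF YZ(1)] C(1)[OF YZ(2)]]
        dimension_strict_mono[OF C(1)[OF YZ(2)] C(1)[OF YZ(1)]]
      by (metis less_irrefl psubsetI)
  qed
  moreover have "dimension ` C \<subseteq> {dimension X..card S}"
    using C assms(3) dimension_mono dimension_le by auto
  ultimately have "card C \<le> card {dimension X..card S}"
    by (intro card_inj_on_le) auto
  then show ?thesis by simp
qed

lemma poset_rank_lattice:
  assumes "X \<in> flat ` Pow E"
  shows "poset_rank lattice X = card S - dimension X"
  unfolding poset_rank_def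
proof (rule Max_eqI)
  have "Chains lattice \<subseteq> Pow (flat ` Pow E)" by (auto simp: Chains_def lattice_eq)
  then show "finite ((\<lambda>C. card C - 1) ` {C \<in> Chains lattice. C \<subseteq> under lattice X})"
    using finite_flats by (auto intro: finite_subset)
  show "k \<le> card S - dimension X"
    if "k \<in> (\<lambda>C. card C - 1) ` {C \<in> Chains lattice. C \<subseteq> under lattice X}" for k
    using that card_chain_le[OF _ _ assms] by fastforce
  obtain B where B: "B \<subseteq> E" "X = flat B" using assms by auto
  obtain C where C: "C \<in> Chains lattice" "C \<subseteq> under lattice X" "Suc (card S) \<le> card C + dimension X"
    using chain_to_flat[OF B(1)] B(2) by auto
  then have "card C - 1 = card S - dimension X"
    using card_chain_le[OF C(1,2) assms] dimension_le[OF assms] by linarith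
  then show "card S - dimension X \<in> (\<lambda>C. card C - 1) ` {C \<in> Chains lattice. C \<subseteq> under lattice X}"
    using C by (auto simp: image_iff intro!: exI[of _ C])
qed

text \<open>The flat of all edges is the top of the lattice, so every chain lies below it and the
  length is its rank.\<close>

lemma poset_length_lattice: "poset_length lattice = card S - 1"
proof -
  have "C \<subseteq> under lattice (flat E)" if "C \<in> Chains lattice" for C
  proof
    fix X assume "X \<in> C"
    then have "(X, X) \<in> lattice" using that by (auto simp: Chains_def)
    then show "X \<in> under lattice (flat E)"
      using flat_antimono[of _ E] by (auto simp: under_def lattice_eq)
  qed
  then have "{C \<in> Chains lattice. C \<subseteq> under lattice (flat E)} = Chains lattice" by blast
  then have "poset_length lattice = poset_rank lattice (flat E)"
    by (simp add: poset_length_def poset_rank_def)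
  then show ?thesis by (simp add: poset_rank_lattice dimension_flat_edges)
qed

section \<open>Counting proper colourings by Moebius inversion\<close>

lemma poly_charpoly_card:
  fixes Q :: "real set"
  assumes "finite Q"
  shows "int (card Q) * poly (poset_charpoly lattice) (int (card Q)) =
    int (card {c \<in> S \<rightarrow>\<^sub>E Q. \<forall>(a, b)\<in>E. c a \<noteq> c b})"
proof -
  let ?L = "flat ` Pow E" and ?q = "int (card Q)" and ?\<mu> = "poset_moebius lattice V"
  have "?q * poly (poset_charpoly lattice) ?q = (\<Sum>X\<in>?L. ?\<mu> X * (?q * ?q ^ (card S - 1 - (card S - dimension X))))"
    by (simp add: poset_charpoly_def Field_lattice poset_bot_lattice poset_length_lattice
        poset_rank_lattice poly_sum poly_monom sum_distrib_left mult_ac cong: sum.cong)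
  also have "\<dots> = (\<Sum>X\<in>?L. ?\<mu> X * ?q ^ dimension X)"
  proof (intro sum.cong refl arg_cong2[where f = "(*)"])
    \<comment> \<open>The exponent of the characteristic polynomial is
      \<open>dimension X - 1\<close>, and the extra factor \<open>card Q\<close> makes up for the 1.
      No subtraction is truncated, as \<open>dimension X\<close> lies between 1 and
      \<open>card S\<close>.\<close>
    fix X assume X: "X \<in> ?L"
    then have "dimension X = Suc (card S - 1 - (card S - dimension X))"
      using dimension_pos[OF X] dimension_le[OF X] by linarith
    then show "?q * ?q ^ (card S - 1 - (card S - dimension X)) = ?q ^ dimension X"
      by (metis power_Suc)
  qed
  also have "\<dots> = (\<Sum>X\<in>?L. \<Sum>c\<in>S \<rightarrow>\<^sub>E Q. if \<psi> c \<in> X then ?\<mu> X else 0)"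
  proof (intro sum.cong refl)
    fix X assume X: "X \<in> ?L"
    have "(\<Sum>c\<in>S \<rightarrow>\<^sub>E Q. if \<psi> c \<in> X then ?\<mu> X else 0) = (\<Sum>c\<in>colourings Q X. ?\<mu> X)"
      unfolding colourings_def
      by (rule sum.inter_filter[symmetric]) (simp add: assms finite_PiE finite_vertices)
    then show "?\<mu> X * ?q ^ dimension X = (\<Sum>c\<in>S \<rightarrow>\<^sub>E Q. if \<psi> c \<in> X then ?\<mu> X else 0)"
      by (simp add: card_colourings[OF X] mult.commute)
  qed
  also have "\<dots> = (\<Sum>c\<in>S \<rightarrow>\<^sub>E Q. \<Sum>X\<in>?L. if \<psi> c \<in> X then ?\<mu> X else 0)"
    by (rule sum.swap)
  also have "\<dots> = (\<Sum>c\<in>S \<rightarrow>\<^sub>E Q. if \<forall>(a, b)\<in>E. c a \<noteq> c b then 1 else 0)"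
  proof (intro sum.cong refl)
    fix c :: "'a \<Rightarrow> real"
    \<comment> \<open>The monochromatic edges of \<open>c\<close>; \<open>flat B\<close> is the
      smallest flat through \<open>\<psi> c\<close>, so the sum over flats through this point is a
      sum over an interval.\<close>
    define B where "B = {(a, b) \<in> E. c a = c b}"
    have BE: "B \<subseteq> E" by (auto simp: B_def)
    have "\<psi> c \<in> X \<longleftrightarrow> flat B \<subseteq> X" if X: "X \<in> ?L" for X
    proof -
      obtain C where C: "C \<subseteq> E" "X = flat C" using X by blast
      have "\<psi> c \<in> flat B" by (simp add: section_flat[OF BE]) (auto simp: B_def)
      moreover have "C \<subseteq> B" if "\<psi> c \<in> X"
        using that C by (auto simp: section_flat B_def)
      ultimately show ?thesis using C(2) flat_antimono by blast
    qed
    then have "(\<Sum>X\<in>?L. if \<psi> c \<in> X then ?\<mu> X else 0) = (\<Sum>X\<in>?L. if flat B \<subseteq> X then ?\<mu> X else 0)"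
      by (intro sum.cong) auto
    also have "\<dots> = (\<Sum>X | X \<in> ?L \<and> flat B \<subseteq> X. ?\<mu> X)"
      by (rule sum.inter_filter[symmetric]) (rule finite_flats)
    also have "\<dots> = (if flat B = V then 1 else 0)"
      by (rule sum_moebius_lattice) (use BE in blast)
    also have "flat B = V \<longleftrightarrow> (\<forall>(a, b)\<in>E. c a \<noteq> c b)"
    proof
      assume *: "flat B = V"
      have False if ab: "(a, b) \<in> E" "c a = c b" for a b
      proof -
        \<comment> \<open>A point of the ambient space that violates the equation of the edge
          \<open>(a, b)\<close> unless \<open>a = b\<close>.\<close>
        have "\<psi> (\<lambda>v. if v = a then 1 else 0) \<in> flat B" using * section_mem by simp
        then have "a = b" using ab unfolding section_flat[OF BE] by (auto simp: B_def split: if_splits)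
        then show False using ab no_loops by blast
      qed
      then show "\<forall>(a, b)\<in>E. c a \<noteq> c b" by blast
    next
      assume "\<forall>(a, b)\<in>E. c a \<noteq> c b"
      then have "B = {}" by (auto simp: B_def)
      then show "flat B = V" by (simp add: flat_empty)
    qed
    finally show "(\<Sum>X\<in>?L. if \<psi> c \<in> X then ?\<mu> X else 0) = (if \<forall>(a, b)\<in>E. c a \<noteq> c b then 1 else 0)" .
  qed
  also have "\<dots> = int (card {c \<in> S \<rightarrow>\<^sub>E Q. \<forall>(a, b)\<in>E. c a \<noteq> c b})"
    by (simp add: sum.inter_filter[symmetric] assms finite_PiE finite_vertices)
  finally show ?thesis .
qed

end

section \<open>Colourings of Ferrers graphs\<close>

text \<open>\<open>Inl i\<close> stands for u_(i+1) and \<open>Inr j\<close> for x_(j+2); these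
  shifts turn the strict inequality between the indices into \<open>i \<le> j\<close>.\<close>

definition ferrers_edges :: "nat \<Rightarrow> ((nat + nat) \<times> (nat + nat)) set" where
  "ferrers_edges n = {(Inl i, Inr j) | i j. i \<le> j \<and> j < n}"

text \<open>The number of ways to extend a colouring \<open>u\<close> of the left vertices to the right ones.\<close>

definition ferrers_weight :: "nat \<Rightarrow> nat \<Rightarrow> (nat \<Rightarrow> 'c) \<Rightarrow> int" where
  "ferrers_weight q n u = (\<Prod>j<n. int q - int (card (u ` {..j})))"

definition ferrers_count :: "'c set \<Rightarrow> nat \<Rightarrow> nat \<Rightarrow> int" where
  "ferrers_count Q n k =
     (\<Sum>u | u \<in> {..<n} \<rightarrow>\<^sub>E Q \<and> card (u ` {..<n}) = k. ferrers_weight (card Q) n u)"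

lemma card_ferrers_colourings:
  assumes "finite Q"
  shows "int (card {c \<in> Inl ` {..<n} \<union> Inr ` {..<n} \<rightarrow>\<^sub>E Q. \<forall>(a, b)\<in>ferrers_edges n. c a \<noteq> c b}) =
    (\<Sum>u\<in>{..<n} \<rightarrow>\<^sub>E Q. ferrers_weight (card Q) n u)"
proof -
  let ?S = "Inl ` {..<n} \<union> Inr ` {..<n} :: (nat + nat) set"
  let ?C = "{c \<in> ?S \<rightarrow>\<^sub>E Q. \<forall>(a, b)\<in>ferrers_edges n. c a \<noteq> c b}"
  let ?P = "SIGMA u:{..<n} \<rightarrow>\<^sub>E Q. \<Pi>\<^sub>E j\<in>{..<n}. Q - u ` {..j}"
  have "bij_betw (\<lambda>c. (\<lambda>i\<in>{..<n}. c (Inl i), \<lambda>j\<in>{..<n}. c (Inr j))) ?C ?P"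
  proof (rule bij_betw_byWitness[where f' = "\<lambda>(u, v). \<lambda>a\<in>?S. case_sum u v a"])
    show "\<forall>c\<in>?C. (case (\<lambda>i\<in>{..<n}. c (Inl i), \<lambda>j\<in>{..<n}. c (Inr j)) of
        (u, v) \<Rightarrow> \<lambda>a\<in>?S. case_sum u v a) = c"
    proof
      fix c assume "c \<in> ?C"
      then have "c \<in> extensional ?S" by (simp add: PiE_def)
      then show "(case (\<lambda>i\<in>{..<n}. c (Inl i), \<lambda>j\<in>{..<n}. c (Inr j)) of
        (u, v) \<Rightarrow> \<lambda>a\<in>?S. case_sum u v a) = c"
        by (auto intro!: extensionalityI[of _ ?S])
    qed
    show "\<forall>p\<in>?P. (\<lambda>c. (\<lambda>i\<in>{..<n}. c (Inl i), \<lambda>j\<in>{..<n}. c (Inr j)))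
        (case p of (u, v) \<Rightarrow> \<lambda>a\<in>?S. case_sum u v a) = p"
      by (auto intro!: extensionalityI[of _ "{..<n}"] simp: PiE_def)
    show "(\<lambda>c. (\<lambda>i\<in>{..<n}. c (Inl i), \<lambda>j\<in>{..<n}. c (Inr j))) ` ?C \<subseteq> ?P"
    proof (rule image_subsetI)
      fix c assume c: "c \<in> ?C"
      then have "c (Inl i) \<noteq> c (Inr j)" if "i \<le> j" "j < n" for i j
        using that by (auto simp: ferrers_edges_def)
      moreover have "c (Inl i) \<in> Q" "c (Inr i) \<in> Q" if "i < n" for i
        using c that by (auto simp: PiE_iff)
      ultimately show "(\<lambda>i\<in>{..<n}. c (Inl i), \<lambda>j\<in>{..<n}. c (Inr j)) \<in> ?P"
        by (auto simp: PiE_iff) metis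
    qed
    show "(\<lambda>(u, v). \<lambda>a\<in>?S. case_sum u v a) ` ?P \<subseteq> ?C"
    proof (rule image_subsetI)
      fix p assume "p \<in> ?P"
      then obtain u v where p: "p = (u, v)" and u: "\<And>i. i < n \<Longrightarrow> u i \<in> Q"
        and v: "\<And>j. j < n \<Longrightarrow> v j \<in> Q" "\<And>i j. i \<le> j \<Longrightarrow> j < n \<Longrightarrow> v j \<noteq> u i"
        by (auto simp: PiE_iff) blast
      have "case_sum u v a \<noteq> case_sum u v b" "a \<in> ?S" "b \<in> ?S" if "(a, b) \<in> ferrers_edges n" for a b
        using that v(2) by (auto simp: ferrers_edges_def dest: sym)
      moreover have "(\<lambda>a\<in>?S. case_sum u v a) \<in> ?S \<rightarrow>\<^sub>E Q"
        using u v(1) by auto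
      ultimately show "(case p of (u, v) \<Rightarrow> \<lambda>a\<in>?S. case_sum u v a) \<in> ?C"
        by (auto simp only: p prod.case mem_Collect_eq restrict_apply if_True)
    qed
  qed
  then have "card ?C = card ?P" by (rule bij_betw_same_card)
  also have "\<dots> = (\<Sum>u\<in>{..<n} \<rightarrow>\<^sub>E Q. \<Prod>j<n. card (Q - u ` {..j}))"
    using assms by (subst card_SigmaI) (auto simp: finite_PiE card_PiE)
  also have "int \<dots> = (\<Sum>u\<in>{..<n} \<rightarrow>\<^sub>E Q. ferrers_weight (card Q) n u)"
    unfolding of_nat_sum of_nat_prod
  proof (intro sum.cong refl)
    fix u assume u: "u \<in> {..<n} \<rightarrow>\<^sub>E Q"
    have "int (card (Q - u ` {..j})) = int (card Q) - int (card (u ` {..j}))" if "j < n" for j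
    proof -
      have "u ` {..j} \<subseteq> Q" using u that by (auto simp: PiE_iff)
      then show ?thesis using assms
        by (simp add: card_Diff_subset finite_subset of_nat_diff card_mono)
    qed
    then show "(\<Prod>j<n. int (card (Q - u ` {..j}))) = ferrers_weight (card Q) n u"
      by (simp add: ferrers_weight_def)
  qed
  finally show ?thesis .
qed

lemma ferrers_count_0: "ferrers_count Q 0 k = (if k = 0 then 1 else 0)"
  by (simp add: ferrers_count_def ferrers_weight_def)

lemma ferrers_count_eq_0:
  assumes "k > n \<or> (n > 0 \<and> k = 0)"
  shows "ferrers_count Q n k = 0"
proof -
  have "card (u ` {..<n}) \<noteq> k" for u :: "nat \<Rightarrow> 'a"
    using assms card_image_le[of "{..<n}" u] by (auto simp: card_eq_0_iff)
  then show ?thesis by (simp add: ferrers_count_def)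
qed

lemma sum_ferrers_weight:
  assumes "finite Q"
  shows "(\<Sum>u\<in>{..<n} \<rightarrow>\<^sub>E Q. ferrers_weight (card Q) n u) = (\<Sum>k\<le>n. ferrers_count Q n k)"
proof -
  have "card (u ` {..<n}) \<in> {..n}" for u :: "nat \<Rightarrow> 'a"
    using card_image_le[of "{..<n}" u] by simp
  then have "(\<lambda>u. card (u ` {..<n})) ` ({..<n} \<rightarrow>\<^sub>E Q) \<subseteq> {..n}" by blast
  then show ?thesis
    unfolding ferrers_count_def
    by (intro sum.group[symmetric]) (simp_all add: assms finite_PiE)
qed

text \<open>
  The new left vertex either repeats one of the \<open>k + 1\<close> colours already seen on the left or adds
  a colour to \<open>k\<close> of them.
\<close>

lemma ferrers_count_Suc:
  assumes "finite Q"
  shows "ferrers_count Q (Suc n) (Suc k) = (int (card Q) - int (Suc k)) *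
    (int (Suc k) * ferrers_count Q n (Suc k) + (int (card Q) - int k) * ferrers_count Q n k)"
proof -
  let ?q = "int (card Q)" and ?F = "{..<n} \<rightarrow>\<^sub>E Q" and ?w = "ferrers_weight (card Q) n"
  let ?im = "\<lambda>u. u ` {..<n}"
  have fin: "finite ?F" using assms by (simp add: finite_PiE)
  have count: "ferrers_count Q n m = (\<Sum>u\<in>?F. if card (?im u) = m then ?w u else 0)" for m
    unfolding ferrers_count_def by (rule sum.inter_filter) (rule fin)
  have img: "(u(n := y)) ` {..<Suc n} = insert y (?im u)" for u and y :: 'a
    by (auto simp: lessThan_Suc)
  have weight: "ferrers_weight (card Q) (Suc n) (u(n := y)) = ?w u * (?q - int (card (insert y (?im u))))"
    for u and y :: 'a
  proof -
    have "(u(n := y)) ` {..j} = u ` {..j}" if "j < n" for j using that by auto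
    then have "(\<Prod>j<n. ?q - int (card ((u(n := y)) ` {..j}))) = ?w u"
      unfolding ferrers_weight_def by (intro prod.cong refl) (simp only: lessThan_iff)
    moreover have "(u(n := y)) ` {..n} = insert y (?im u)"
      using img by (simp only: lessThan_Suc_atMost)
    ultimately show ?thesis
      unfolding ferrers_weight_def[of _ "Suc n"] prod.lessThan_Suc by (simp only:)
  qed
  have "ferrers_count Q (Suc n) (Suc k) = (\<Sum>u\<in>{..<Suc n} \<rightarrow>\<^sub>E Q.
      if card (u ` {..<Suc n}) = Suc k then ferrers_weight (card Q) (Suc n) u else 0)"
    unfolding ferrers_count_def by (rule sum.inter_filter) (simp add: assms finite_PiE)
  also have "{..<Suc n} \<rightarrow>\<^sub>E Q = (\<lambda>(y, u). u(n := y)) ` (Q \<times> ?F)"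
    by (simp add: lessThan_Suc PiE_insert_eq)
  also have "(\<Sum>u\<in>\<dots>. if card (u ` {..<Suc n}) = Suc k then ferrers_weight (card Q) (Suc n) u else 0) =
      (\<Sum>p\<in>Q \<times> ?F. let u = (\<lambda>(y, u). u(n := y)) p in
         if card (u ` {..<Suc n}) = Suc k then ferrers_weight (card Q) (Suc n) u else 0)"
    unfolding Let_def by (rule sum.reindex[OF inj_combinator, unfolded o_def]) simp
  \<comment> \<open>The condition on the number of left colours also fixes the last factor of the
    weight, which belongs to the new right vertex.\<close>
  also have "\<dots> = (\<Sum>(y, u)\<in>Q \<times> ?F. if card (insert y (?im u)) = Suc k
         then ?w u * (?q - int (Suc k)) else 0)"
    unfolding Let_def split_def img weight by (intro sum.cong refl) (auto split: if_split simp del: of_nat_Suc)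
  also have "\<dots> = (\<Sum>u\<in>?F. \<Sum>y\<in>Q. if card (insert y (?im u)) = Suc k
         then ?w u * (?q - int (Suc k)) else 0)"
    by (subst sum.swap) (simp add: sum.cartesian_product)
  also have "\<dots> = (\<Sum>u\<in>?F. (?q - int (Suc k)) *
      (int (Suc k) * (if card (?im u) = Suc k then ?w u else 0) +
       (?q - int k) * (if card (?im u) = k then ?w u else 0)))"
  proof (intro sum.cong refl)
    fix u assume u: "u \<in> ?F"
    have sub: "?im u \<subseteq> Q" using u by (auto simp: PiE_iff)
    have diff: "int (card (Q - ?im u)) = ?q - int (card (?im u))"
      using sub assms by (simp add: card_Diff_subset of_nat_diff card_mono)
    have "(\<Sum>y\<in>Q. if card (insert y (?im u)) = Suc k then ?w u * (?q - int (Suc k)) else 0) =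
        (\<Sum>y\<in>?im u. if card (insert y (?im u)) = Suc k then ?w u * (?q - int (Suc k)) else 0) +
        (\<Sum>y\<in>Q - ?im u. if card (insert y (?im u)) = Suc k then ?w u * (?q - int (Suc k)) else 0)"
      using assms by (simp add: sum.subset_diff[OF sub])
    also have "(\<Sum>y\<in>?im u. if card (insert y (?im u)) = Suc k then ?w u * (?q - int (Suc k)) else 0) =
        (\<Sum>y\<in>?im u. if card (?im u) = Suc k then ?w u * (?q - int (Suc k)) else 0)"
      by (intro sum.cong refl) (simp add: insert_absorb)
    also have "(\<Sum>y\<in>Q - ?im u. if card (insert y (?im u)) = Suc k then ?w u * (?q - int (Suc k)) else 0) =
        (\<Sum>y\<in>Q - ?im u. if card (?im u) = k then ?w u * (?q - int (Suc k)) else 0)"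
      by (intro sum.cong refl) simp
    finally show "(\<Sum>y\<in>Q. if card (insert y (?im u)) = Suc k then ?w u * (?q - int (Suc k)) else 0) =
        (?q - int (Suc k)) * (int (Suc k) * (if card (?im u) = Suc k then ?w u else 0) +
         (?q - int k) * (if card (?im u) = k then ?w u else 0))"
      using diff by auto
  qed
  also have "\<dots> = (?q - int (Suc k)) *
      (int (Suc k) * ferrers_count Q n (Suc k) + (?q - int k) * ferrers_count Q n k)"
    unfolding count by (simp only: sum.distrib sum_distrib_left distrib_left)
  finally show ?thesis .
qed

section \<open>The power series on the right-hand side\<close>

text \<open>Convergence of power series is coefficientwise, and each coefficient of the partial sums
  is eventually constant.\<close>

lemma fps_sums_graded:
  fixes f :: "nat \<Rightarrow> 'a::comm_ring_1 fps"
  assumes "\<And>m n. n < m \<Longrightarrow> fps_nth (f m) n = 0"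
  shows "f sums Abs_fps (\<lambda>n. \<Sum>m\<le>n. fps_nth (f m) n)"
  unfolding sums_def
proof (rule tendsto_fpsI)
  fix n
  have "fps_nth (\<Sum>m<N. f m) n = fps_nth (Abs_fps (\<lambda>n. \<Sum>m\<le>n. fps_nth (f m) n)) n" if "n < N" for N
    unfolding fps_sum_nth fps_nth_Abs_fps
    by (rule sum.mono_neutral_right) (use that assms in auto)
  then show "\<forall>\<^sub>F N in sequentially. fps_nth (\<Sum>m<N. f m) n =
      fps_nth (Abs_fps (\<lambda>n. \<Sum>m\<le>n. fps_nth (f m) n)) n"
    by (rule eventually_mono[OF eventually_gt_at_top])
qed

definition genocchi_denominator :: "nat \<Rightarrow> int poly fps" where
  "genocchi_denominator n = (\<Prod>k=1..n. 1 - fps_const (of_nat k * ([:0, 1:] - of_nat k)) * fps_X)"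

text \<open>The \<open>n\<close>-th summand of the right-hand side, with \<open>[:0, 1:]\<close> for
  t.\<close>

definition genocchi_term :: "nat \<Rightarrow> int poly fps" where
  "genocchi_term n = fps_quotient
     (fps_const (falling_factorial ([:0, 1:] - 1) n * falling_factorial ([:0, 1:] - 1) (n - 1)) * fps_X ^ n)
     (genocchi_denominator n)"

lemma genocchi_denominator_Suc:
  "genocchi_denominator (Suc n) = genocchi_denominator n *
     (1 - fps_const (of_nat (Suc n) * ([:0, 1:] - of_nat (Suc n))) * fps_X)"
  by (simp add: genocchi_denominator_def)

lemma genocchi_denominator_nth_0: "fps_nth (genocchi_denominator n) 0 = 1"
  by (induction n) (simp_all add: genocchi_denominator_Suc del: of_nat_Suc, simp add: genocchi_denominator_def)

lemma genocchi_denominator_mult_term: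
  "genocchi_denominator n * genocchi_term n =
     fps_const (falling_factorial ([:0, 1:] - 1) n * falling_factorial ([:0, 1:] - 1) (n - 1)) * fps_X ^ n"
  unfolding genocchi_term_def by (rule fps_quotient_mult) (rule genocchi_denominator_nth_0)

lemma genocchi_term_nth_less:
  assumes "m < n"
  shows "fps_nth (genocchi_term n) m = 0"
  by (simp add: genocchi_term_def fps_quotient_def mult.assoc fps_X_power_mult_nth assms)

lemma falling_factorial_Suc: "falling_factorial a (Suc n) = falling_factorial a n * (a - of_nat n)"
  by (simp add: falling_factorial_def mult.commute)

text \<open>The start of the recursion is separate: from index 0 to 1 only one of the two falling
  factorials gains a factor, since \<open>n - 1\<close> is truncated at 0.\<close>

lemma genocchi_term_1:
  "(1 - fps_const ([:0, 1:] - 1) * fps_X) * genocchi_term 1 = fps_const ([:0, 1:] - 1) * fps_X"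
  using genocchi_denominator_mult_term[of 1]
  by (simp add: genocchi_denominator_def falling_factorial_def)

text \<open>Each falling factorial gains one factor and the denominator gains one. The common
  denominator cancels because its constant coefficient is 1, hence it is nonzero.\<close>

lemma genocchi_term_Suc:
  assumes "n \<ge> 1"
  shows "(1 - fps_const (of_nat (Suc n) * ([:0, 1:] - of_nat (Suc n))) * fps_X) * genocchi_term (Suc n) =
    fps_const (([:0, 1:] - of_nat (Suc n)) * ([:0, 1:] - of_nat n)) * fps_X * genocchi_term n"
    (is "?d * _ = ?c * fps_X * _")
proof -
  let ?a = "[:0, 1:] - 1 :: int poly"
  obtain m where m: "n = Suc m" using assms by (cases n) auto
  have ff: "falling_factorial ?a (Suc n) = falling_factorial ?a n * ([:0, 1:] - of_nat (Suc n))"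
    "falling_factorial ?a n = falling_factorial ?a (n - 1) * ([:0, 1:] - of_nat n)"
    by (simp_all add: falling_factorial_Suc m)
  have "genocchi_denominator n * (?d * genocchi_term (Suc n)) =
      fps_const (falling_factorial ?a (Suc n) * falling_factorial ?a n) * fps_X ^ Suc n"
    using genocchi_denominator_mult_term[of "Suc n"]
    by (simp add: genocchi_denominator_Suc mult.assoc del: of_nat_Suc)
  also have "\<dots> = ?c * fps_X * (fps_const (falling_factorial ?a n * falling_factorial ?a (n - 1)) * fps_X ^ n)"
    unfolding ff(1) by (subst (2) ff(2)) (simp only: fps_const_mult[symmetric] power_Suc mult_ac)
  also have "\<dots> = genocchi_denominator n * (?c * fps_X * genocchi_term n)"
    unfolding genocchi_denominator_mult_term[symmetric] by (simp only: mult_ac)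
  finally show ?thesis
    using genocchi_denominator_nth_0[of n] by (subst (asm) mult_left_cancel) auto
qed

lemma genocchi_term_1_nth:
  "fps_nth (genocchi_term (Suc 0)) (Suc n) =
    ([:0, 1:] - 1) * (fps_nth (genocchi_term (Suc 0)) n + (if n = 0 then 1 else 0))"
  using arg_cong[OF genocchi_term_1, of "\<lambda>f. fps_nth f (Suc n)"]
  by (simp add: algebra_simps)

text \<open>Comparing coefficients gives the recursion of \<open>ferrers_count_Suc\<close>, with t
  in place of \<open>card Q\<close>.\<close>

lemma genocchi_term_Suc_nth:
  assumes "k \<ge> 1"
  shows "fps_nth (genocchi_term (Suc k)) (Suc n) = ([:0, 1:] - of_nat (Suc k)) *
    (of_nat (Suc k) * fps_nth (genocchi_term (Suc k)) n + ([:0, 1:] - of_nat k) * fps_nth (genocchi_term k) n)"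
  using arg_cong[OF genocchi_term_Suc[OF assms], of "\<lambda>f. fps_nth f (Suc n)"]
  by (simp add: left_diff_distrib mult.assoc distrib_left del: of_nat_Suc fps_const_mult) (simp add: algebra_simps del: of_nat_Suc)

section \<open>The homogenized Linial arrangement\<close>

text \<open>Both sides obey the same recursion and agree at \<open>n = 0\<close>. The factor
  \<open>[:0, 1:]\<close> counts the choices of the first left colour; for \<open>k = 0\<close> only
  the empty colouring remains.\<close>

lemma ferrers_count_eq_poly:
  assumes "finite Q"
  shows "ferrers_count Q n k =
    poly (fps_nth (if k = 0 then 1 else fps_const [:0, 1:] * genocchi_term k) n) (int (card Q))"
proof (induction n arbitrary: k)
  case 0
  show ?case by (cases k) (simp_all add: ferrers_count_0 genocchi_term_nth_less)
next
  case (Suc n)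
  show ?case
  proof (cases k)
    case 0
    then show ?thesis by (simp add: ferrers_count_eq_0)
  next
    case (Suc m)
    show ?thesis
    proof (cases m)
      case 0
      then show ?thesis
        by (simp add: \<open>k = Suc m\<close> ferrers_count_Suc[OF assms] Suc.IH genocchi_term_1_nth algebra_simps)
    next
      case (Suc l)
      then have "m \<ge> 1" by simp
      with \<open>k = Suc m\<close> show ?thesis
        by (simp add: ferrers_count_Suc[OF assms] Suc.IH genocchi_term_Suc_nth[of m]
            del: of_nat_Suc) (simp add: algebra_simps)
    qed
  qed
qed

definition linial_coords :: "nat \<Rightarrow> real vec \<Rightarrow> nat + nat \<Rightarrow> real" where
  "linial_coords n v = case_sum (\<lambda>i. v $ i - v $ (n + 1 + i)) (\<lambda>j. v $ (j + 1))"

text \<open>The vertices leave two coordinates of the space undetermined. Here x_1 is set to 0, and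
  y_(n+1) is computed from the value of \<open>w\<close> at \<open>Inl n\<close>, which is not a
  vertex.\<close>

definition linial_section :: "nat \<Rightarrow> (nat + nat \<Rightarrow> real) \<Rightarrow> real vec" where
  "linial_section n w =
     (let x = (\<lambda>k. if k = 0 then 0 else w (Inr (k - 1)))
      in vec (2 * n + 2) (\<lambda>k. if k \<le> n then x k else x (k - (n + 1)) - w (Inl (k - (n + 1)))))"

lemma graphical_arrangement_linial:
  assumes "n \<ge> 1"
  shows "graphical_arrangement (carrier_vec (2 * n + 2)) (Inl ` {..<n} \<union> Inr ` {..<n})
    (ferrers_edges n) (linial_coords n) (linial_section n)"
proof
  show "linial_coords n (linial_section n w) a = w a" if "a \<in> Inl ` {..<n} \<union> Inr ` {..<n}" for w a
    using that by (auto simp: linial_coords_def linial_section_def Let_def)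
next
  fix w :: "nat + nat \<Rightarrow> real" and a b
  assume w: "\<And>a b. (a, b) \<in> ferrers_edges n \<Longrightarrow> w a = w b"
    and ab: "a \<in> Inl ` {..<n} \<union> Inr ` {..<n}" "b \<in> Inl ` {..<n} \<union> Inr ` {..<n}"
  \<comment> \<open>Every left vertex is adjacent to the last right vertex, and every right vertex
    to the first left one.\<close>
  have left: "w (Inl i) = w (Inr (n - 1))" if "i < n" for i
    using that by (intro w) (auto simp: ferrers_edges_def)
  have right: "w (Inr j) = w (Inr (n - 1))" if "j < n" for j
  proof -
    have "w (Inl 0) = w (Inr j)"
      using that by (intro w) (auto simp: ferrers_edges_def)
    moreover have "w (Inl 0) = w (Inr (n - 1))" using left assms by simp
    ultimately show ?thesis by (rule trans[OF sym])
  qed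
  have "w c = w (Inr (n - 1))" if "c \<in> Inl ` {..<n} \<union> Inr ` {..<n}" for c
    using that by (elim UnE imageE) (blast intro: left right)+
  from this[OF ab(1)] this[OF ab(2)] show "w a = w b" by (rule trans[OF _ sym])
qed (use assms in \<open>auto simp: ferrers_edges_def linial_section_def Let_def lessThan_empty_iff\<close>)

text \<open>The equation x_i - x_j = y_i says that u_i = x_i - y_i equals x_j.\<close>

lemma homogenized_linial_eq:
  "homogenized_linial n =
    (\<lambda>(a, b). {v \<in> carrier_vec (2 * n + 2). linial_coords n v a = linial_coords n v b}) ` ferrers_edges n"
    (is "_ = ?h ` _")
proof
  have h: "?h (Inl (i - 1), Inr (j - 2)) =
      {v \<in> carrier_vec (2 * n + 2). coord_x v i - coord_x v j = coord_y n v i}"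
    if "1 \<le> i" "i < j" for i j
  proof -
    have "n + 1 + (i - 1) = n + i" "j - 2 + 1 = j - 1" using that by auto
    then show ?thesis by (auto simp: linial_coords_def coord_x_def coord_y_def)
  qed
  show "homogenized_linial n \<subseteq> ?h ` ferrers_edges n"
  proof
    fix H assume "H \<in> homogenized_linial n"
    then obtain i j where ij: "1 \<le> i" "i < j" "j \<le> n + 1"
      and H: "H = {v \<in> carrier_vec (2 * n + 2). coord_x v i - coord_x v j = coord_y n v i}"
      by (auto simp: homogenized_linial_def)
    have "(Inl (i - 1), Inr (j - 2)) \<in> ferrers_edges n" using ij by (auto simp: ferrers_edges_def)
    then show "H \<in> ?h ` ferrers_edges n" unfolding H h[OF ij(1,2), symmetric] by (rule imageI)
  qed
  show "?h ` ferrers_edges n \<subseteq> homogenized_linial n"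
  proof
    fix H assume "H \<in> ?h ` ferrers_edges n"
    then obtain i j where ij: "i \<le> j" "j < n" and H: "H = ?h (Inl i, Inr j)"
      by (auto simp: ferrers_edges_def)
    have "H = {v \<in> carrier_vec (2 * n + 2). coord_x v (i + 1) - coord_x v (j + 2) = coord_y n v (i + 1)}"
      using h[of "i + 1" "j + 2"] ij H by simp
    then show "H \<in> homogenized_linial n"
      using ij unfolding homogenized_linial_def
      by (intro CollectI exI[of _ "i + 1"] exI[of _ "j + 2"]) auto
  qed
qed

text \<open>After division by q, the two polynomials agree at every integer q from 1 on, and so they
  are equal.\<close>

lemma linial_charpoly_eq_sum:
  assumes "n \<ge> 1"
  shows "linial_charpoly n = (\<Sum>k=1..n. fps_nth (genocchi_term k) n)" (is "_ = ?r")
proof -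
  interpret graphical_arrangement "carrier_vec (2 * n + 2)" "Inl ` {..<n} \<union> Inr ` {..<n}"
    "ferrers_edges n" "linial_coords n" "linial_section n"
    by (rule graphical_arrangement_linial[OF assms])
  have charpoly: "linial_charpoly n = poset_charpoly lattice"
    unfolding linial_charpoly_def lattice_def arrangement_def homogenized_linial_eq ..
  have "poly (linial_charpoly n - ?r) (int q) = 0" if "q \<ge> 1" for q
  proof -
    define Q where "Q = real ` {..<q}"
    have Q: "finite Q" "card Q = q" by (simp_all add: Q_def card_image)
    have "int q * poly (linial_charpoly n) (int q) = (\<Sum>k\<le>n. ferrers_count Q n k)"
      using poly_charpoly_card[OF Q(1)] card_ferrers_colourings[OF Q(1), of n]
        sum_ferrers_weight[OF Q(1), of n]
      by (simp add: charpoly Q(2))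
    \<comment> \<open>As \<open>n \<ge> 1\<close>, some left colour is used and the summand for
      \<open>k = 0\<close> vanishes.\<close>
    also have "\<dots> = (\<Sum>k=1..n. ferrers_count Q n k)"
      by (rule sum.mono_neutral_right) (use assms in \<open>auto simp: not_le intro!: ferrers_count_eq_0\<close>)
    also have "\<dots> = (\<Sum>k=1..n. int q * poly (fps_nth (genocchi_term k) n) (int q))"
      by (intro sum.cong refl) (simp add: ferrers_count_eq_poly[OF Q(1)] Q(2))
    also have "\<dots> = int q * poly ?r (int q)"
      by (simp add: poly_sum sum_distrib_left)
    finally show ?thesis using that by simp
  qed
  then have "int ` {1..} \<subseteq> {x. poly (linial_charpoly n - ?r) x = 0}" by auto
  moreover have "infinite (int ` {1..})" by (simp add: finite_image_iff infinite_Ici)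
  ultimately have "infinite {x. poly (linial_charpoly n - ?r) x = 0}" by (meson finite_subset)
  then have "linial_charpoly n - ?r = 0" using poly_roots_finite by blast
  then show ?thesis by simp
qed

theorem theorem3p7:
  fixes t :: "int poly"
    and lhs rhs :: "nat \<Rightarrow> int poly fps"
  defines "t \<equiv> [:0, 1:]"
    and "lhs \<equiv> \<lambda>n. fps_const (linial_charpoly n) * fps_X ^ n"
    and "rhs \<equiv> \<lambda>n. fps_quotient
           (fps_const (falling_factorial (t - 1) n * falling_factorial (t - 1) (n - 1)) * fps_X ^ n)
           (\<Prod>k=1..n. 1 - fps_const (of_nat k * (t - of_nat k)) * fps_X)"
  shows "summable (\<lambda>m. lhs (Suc m)) \<and> summable (\<lambda>m. rhs (Suc m)) \<and>
    (\<Sum>m. lhs (Suc m)) = (\<Sum>m. rhs (Suc m))"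
proof -
  have rhs: "rhs n = genocchi_term n" for n
    by (simp add: rhs_def t_def genocchi_term_def genocchi_denominator_def)
  have lhs_nth: "fps_nth (lhs m) n = (if n = m then linial_charpoly m else 0)" for m n
    by (simp add: lhs_def)
  have lhs_sums: "(\<lambda>m. lhs (Suc m)) sums Abs_fps (\<lambda>n. \<Sum>m\<le>n. fps_nth (lhs (Suc m)) n)"
    by (rule fps_sums_graded) (simp add: lhs_nth)
  have rhs_sums: "(\<lambda>m. rhs (Suc m)) sums Abs_fps (\<lambda>n. \<Sum>m\<le>n. fps_nth (rhs (Suc m)) n)"
    by (rule fps_sums_graded) (simp add: rhs genocchi_term_nth_less)
  have "(\<Sum>m\<le>n. fps_nth (lhs (Suc m)) n) = (\<Sum>m\<le>n. fps_nth (rhs (Suc m)) n)" for n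
  proof -
    \<comment> \<open>The sum runs up to index \<open>n + 1\<close>, but on either side that summand
      has no term of degree \<open>n\<close>.\<close>
    have shift: "(\<Sum>m\<le>n. f (Suc m)) = (\<Sum>k=1..n. f k) + f (Suc n)" for f :: "nat \<Rightarrow> int poly"
      using sum.atLeast1_atMost_eq[of f "Suc n"] by (simp add: lessThan_Suc_atMost)
    have "(\<Sum>m\<le>n. fps_nth (lhs (Suc m)) n) = (if n \<ge> 1 then linial_charpoly n else 0)"
      unfolding shift[of "\<lambda>k. fps_nth (lhs k) n"] by (simp add: lhs_nth)
    also have "\<dots> = (\<Sum>k=1..n. fps_nth (rhs k) n)"
      by (auto simp: linial_charpoly_eq_sum rhs not_le)
    also have "\<dots> = (\<Sum>m\<le>n. fps_nth (rhs (Suc m)) n)"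
      unfolding shift[of "\<lambda>k. fps_nth (rhs k) n"] by (simp add: rhs genocchi_term_nth_less)
    finally show ?thesis .
  qed
  with lhs_sums rhs_sums show ?thesis
    by (simp add: sums_iff)
qed

end
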